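(* Let $f:\mathbb{R}^d\to\mathbb{R}$ be Lipschitz continuous, $x_0\in\mathbb{R}^d$, $T>0$, and let $m\ge 1$, $n\ge 1$ be integers. Let $\{Q^{(m)}_t\}_{t>0}$ be the weak approximation operators with Malliavin weights $M^{(m)}_t(x,W_t)$, and let $\{\bar X^{(n)}_{kT/n}\}_{0\le k\le n}$ be the Euler-Maruyama discretization started at $x_0$, both as defined in the context. Then $$ \big((Q^{(m)}_{T/n})^n f\big)(x_0)=\mathrm{argmin}_{v\in\mathbb{R}}\; E\left[\left|\,v-f\big(\bar X^{(n)}_{T}\big)\prod_{i=1}^{n}M^{(m)}_{T/n}\big(\bar X^{(n)}_{(i-1)T/n},\,W_{iT/n}-W_{(i-1)T/n}\big)\right|^2\right]. $$
   Context: Let $(\Omega,\mathcal{F},P)$ be the $d$-dimensional Wiener space over $[0,T]$ and let $W=(W^1,\dots,W^d)$ be a $d$-dimensional Brownian motion on it. Let $b,\sigma_1,\dots,\sigma_d\in C_b^\infty(\mathbb{R}^d;\mathbb{R}^d)$, let $\sigma=(\sigma_1,\dots,\sigma_d)$ be the $d\times d$ matrix with columns $\sigma_i$, and assume there is $\varepsilon_0>0$ with $\sigma(x)\sigma(x)^\top\ge\varepsilon_0 I$ for all $x\in\mathbb{R}^d$. Let $X^x$ solve $$X_t^x=x+\int_0^t b(X_s^x)\,ds+\sum_{i=1}^d\int_0^t\sigma_i(X_s^x)\,dW_s^i,$$ and let $(P_tf)(x)=E[f(X_t^x)]$. One-step Euler-Maruyama approximation: $\bar X_t^x=x+b(x)t+\sum_{i=1}^d\sigma_i(x)W_t^i$.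 Malliavin weights and operators: for $m\ge1$, the $m$-th order Malliavin weight is given by a function $(t,x,w)\mapsto M^{(m)}_t(x,w)\in\mathbb{R}$ ($t>0$, $x,w\in\mathbb{R}^d$) which, for each fixed $t$, is a polynomial in $w$ whose coefficients are continuous functions of $x$ of at most polynomial growth. The associated linear operators are $$(Q^{(m)}_tf)(x)=E\big[f(\bar X_t^x)\,M^{(m)}_t(x,W_t)\big],$$ and the weight is such that $\|P_tf-Q^{(m)}_tf\|_\infty=O(t^{m+1})$ for all $f\in C_b^\infty(\mathbb{R}^d)$. (For $m=1$ the weight is $M^{(1)}_t\equiv1$.) The operators are defined by this formula for Lipschitz continuous $f$ and, more generally, for measurable $f$ of at most polynomial growth, so that the $n$-fold composition $(Q^{(m)}_{T/n})^n$ applied to $f$ makes sense. Euler-Maruyama discretization: $\bar X^{(n)}_0=x_0$ and, for $1\le k\le n$, $$\bar X^{(n)}_{kT/n}=\bar X^{(n)}_{(k-1)T/n}+b\big(\bar X^{(n)}_{(k-1)T/n}\big)\frac{T}{n}+\sum_{i=1}^d\sigma_i\big(\bar X^{(n)}_{(k-1)T/n}\big)\big(W^i_{kT/n}-W^i_{(k-1)T/n}\big).$$ Here $\mathrm{argmin}_{v\in\mathbb{R}}$ denotes the unique minimizer over $v\in\mathbb{R}$. *)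

theory Defs
  imports "HOL-Probability.Probability"
begin

primrec iter_partial ::
    "'d::finite list \<Rightarrow> (real^'d \<Rightarrow> 'b::real_normed_vector) \<Rightarrow> real^'d \<Rightarrow> 'b" where
  "iter_partial [] g = g"
| "iter_partial (i # is) g = (\<lambda>x. frechet_derivative (iter_partial is g) (at x) (axis i 1))"

text \<open>Every iterated partial derivative, the function itself included, exists as a (Frechet)
  differentiable function on the whole space and is bounded.\<close>

definition Cb_inf :: "(real^'d::finite \<Rightarrow> 'b::real_normed_vector) set" where
  "Cb_inf = {g. \<forall>is. (\<forall>x. iter_partial is g differentiable (at x))
                     \<and> bounded (range (iter_partial is g))}"

text \<open>The density below is that of the centred Gaussian law with covariance matrix \<open>t - s\<close> times
  the identity; \<open>normal_density\<close> takes the standard deviation as its second argument.\<close>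

definition brownian_motion ::
    "'w measure \<Rightarrow> real \<Rightarrow> (real \<Rightarrow> 'w \<Rightarrow> real^'d::finite) \<Rightarrow> bool" where
  "brownian_motion M T W \<longleftrightarrow>
     prob_space M \<and>
     (\<forall>t\<in>{0..T}. W t \<in> borel_measurable M) \<and>
     (AE \<omega> in M. W 0 \<omega> = 0) \<and>
     (AE \<omega> in M. continuous_on {0..T} (\<lambda>t. W t \<omega>)) \<and>
     (\<forall>s t. 0 \<le> s \<longrightarrow> s < t \<longrightarrow> t \<le> T \<longrightarrow>
        distributed M lborel (\<lambda>\<omega>. W t \<omega> - W s \<omega>)
          (\<lambda>y. ennreal (\<Prod>i\<in>UNIV. normal_density 0 (sqrt (t - s)) (y $ i)))) \<and>
     (\<forall>(n::nat) \<tau>. (\<forall>k\<le>n. \<tau> k \<in> {0..T}) \<longrightarrow> (\<forall>k<n. \<tau> k < \<tau> (Suc k)) \<longrightarrow>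
        prob_space.indep_vars M (\<lambda>_. borel) (\<lambda>k \<omega>. W (\<tau> (Suc k)) \<omega> - W (\<tau> k) \<omega>) {..<n})"

text \<open>A path is a function on \<open>{0..T}\<close>, hence the restriction to \<open>extensional {0..T}\<close>.\<close>

definition wiener_paths :: "real \<Rightarrow> (real \<Rightarrow> real^'d::finite) set" where
  "wiener_paths T = {\<omega> \<in> extensional {0..T}. continuous_on {0..T} \<omega> \<and> \<omega> 0 = 0}"

text \<open>The probability space of continuous paths started at 0, with the completion of the
  cylinder sigma-algebra under the measure that makes the coordinate process a Brownian
  motion. The trace of the product sigma-algebra on the path space is its Borel sigma-algebra
  for the uniform norm.\<close>

definition wiener_space :: "real \<Rightarrow> (real \<Rightarrow> real^'d::finite) measure \<Rightarrow> bool" where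
  "wiener_space T M \<longleftrightarrow>
     (\<exists>N. sets N = sets (restrict_space (\<Pi>\<^sub>M t\<in>{0..T}. borel) (wiener_paths T)) \<and>
          brownian_motion N T (\<lambda>t \<omega>. \<omega> t) \<and>
          M = completion N)"

definition brownian_filtration ::
    "'w measure \<Rightarrow> (real \<Rightarrow> 'w \<Rightarrow> real^'d::finite) \<Rightarrow> real \<Rightarrow> 'w measure" where
  "brownian_filtration M W t =
     sigma (space M)
       ({W s -` A \<inter> space M | s A. s \<in> {0..t} \<and> A \<in> sets borel} \<union> null_sets M)"

text \<open>The triple \<open>(N, \<tau>, \<xi>)\<close> represents the bounded simple process on \<open>(0, t]\<close> with value
  \<open>\<xi> k\<close> on \<open>(\<tau> k, \<tau> (k + 1)]\<close>.\<close>

definition simple_process ::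
    "'w measure \<Rightarrow> (real \<Rightarrow> 'w measure) \<Rightarrow> real \<Rightarrow> nat \<Rightarrow> (nat \<Rightarrow> real) \<Rightarrow>
     (nat \<Rightarrow> 'w \<Rightarrow> 'b::euclidean_space) \<Rightarrow> bool" where
  "simple_process M F t N \<tau> \<xi> \<longleftrightarrow>
     \<tau> 0 = 0 \<and> \<tau> N = t \<and> (\<forall>k<N. \<tau> k < \<tau> (Suc k)) \<and>
     (\<forall>k<N. \<xi> k \<in> borel_measurable (F (\<tau> k))) \<and>
     (\<exists>C. \<forall>k<N. \<forall>\<omega>\<in>space M. norm (\<xi> k \<omega>) \<le> C)"

definition simple_value ::
    "nat \<Rightarrow> (nat \<Rightarrow> real) \<Rightarrow> (nat \<Rightarrow> 'w \<Rightarrow> 'b::euclidean_space) \<Rightarrow> real \<Rightarrow> 'w \<Rightarrow> 'b" where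
  "simple_value N \<tau> \<xi> s \<omega> = (\<Sum>k<N. indicator {\<tau> k<..\<tau> (Suc k)} s *\<^sub>R \<xi> k \<omega>)"

definition simple_integral ::
    "(real \<Rightarrow> 'w \<Rightarrow> real) \<Rightarrow> nat \<Rightarrow> (nat \<Rightarrow> real) \<Rightarrow> (nat \<Rightarrow> 'w \<Rightarrow> 'b::euclidean_space) \<Rightarrow>
     'w \<Rightarrow> 'b" where
  "simple_integral B N \<tau> \<xi> \<omega> = (\<Sum>k<N. (B (\<tau> (Suc k)) \<omega> - B (\<tau> k) \<omega>) *\<^sub>R \<xi> k \<omega>)"

text \<open>\<open>I\<close> is (a version of) the Ito integral over \<open>{0..t}\<close> of \<open>H\<close> against the scalar Brownian
  motion \<open>B\<close>: \<open>H\<close> is a limit in mean square, over time and probability space, of simple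
  processes whose elementary integrals converge in mean square to \<open>I\<close>.\<close>

definition has_ito_integral ::
    "'w measure \<Rightarrow> (real \<Rightarrow> 'w measure) \<Rightarrow> (real \<Rightarrow> 'w \<Rightarrow> real) \<Rightarrow> real \<Rightarrow>
     (real \<Rightarrow> 'w \<Rightarrow> 'b::euclidean_space) \<Rightarrow> ('w \<Rightarrow> 'b) \<Rightarrow> bool" where
  "has_ito_integral M F B t H I \<longleftrightarrow>
     (\<lambda>(s, \<omega>). H s \<omega>) \<in> borel_measurable (restrict_space lborel {0..t} \<Otimes>\<^sub>M M) \<and>
     I \<in> borel_measurable M \<and>
     (\<exists>N \<tau> \<xi>.
        (\<forall>j::nat. simple_process M F t (N j) (\<tau> j) (\<xi> j)) \<and>
        (\<lambda>j. \<integral>\<^sup>+\<omega>. (\<integral>\<^sup>+s\<in>{0..t}.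
            ennreal ((norm (H s \<omega> - simple_value (N j) (\<tau> j) (\<xi> j) s \<omega>))\<^sup>2) \<partial>lborel) \<partial>M)
          \<longlonglongrightarrow> 0 \<and>
        (\<lambda>j. \<integral>\<^sup>+\<omega>.
            ennreal ((norm (I \<omega> - simple_integral B (N j) (\<tau> j) (\<xi> j) \<omega>))\<^sup>2) \<partial>M)
          \<longlonglongrightarrow> 0)"

definition diffusion_matrix ::
    "('d::finite \<Rightarrow> real^'d \<Rightarrow> real^'d) \<Rightarrow> real^'d \<Rightarrow> real^'d^'d" where
  "diffusion_matrix \<sigma> x = (\<chi> j i. \<sigma> i x $ j)"

definition uniformly_elliptic :: "('d::finite \<Rightarrow> real^'d \<Rightarrow> real^'d) \<Rightarrow> bool" where
  "uniformly_elliptic \<sigma> \<longleftrightarrow>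
     (\<exists>\<epsilon>>0. \<forall>x y.
        y \<bullet> ((diffusion_matrix \<sigma> x ** transpose (diffusion_matrix \<sigma> x)) *v y) \<ge> \<epsilon> * (y \<bullet> y))"

definition sde_solution ::
    "'w measure \<Rightarrow> real \<Rightarrow> (real \<Rightarrow> 'w \<Rightarrow> real^'d::finite) \<Rightarrow> (real^'d \<Rightarrow> real^'d) \<Rightarrow>
     ('d \<Rightarrow> real^'d \<Rightarrow> real^'d) \<Rightarrow> real^'d \<Rightarrow> (real \<Rightarrow> 'w \<Rightarrow> real^'d) \<Rightarrow> bool" where
  "sde_solution M T W b \<sigma> x X \<longleftrightarrow>
     (\<forall>t\<in>{0..T}. X t \<in> borel_measurable (brownian_filtration M W t)) \<and>
     (\<forall>\<omega>\<in>space M. continuous_on {0..T} (\<lambda>t. X t \<omega>)) \<and>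
     (\<forall>t\<in>{0..T}. \<exists>I.
        (\<forall>i. has_ito_integral M (brownian_filtration M W) (\<lambda>s \<omega>. W s \<omega> $ i) t
               (\<lambda>s \<omega>. \<sigma> i (X s \<omega>)) (I i)) \<and>
        (AE \<omega> in M. X t \<omega> = x + integral {0..t} (\<lambda>s. b (X s \<omega>)) + (\<Sum>i\<in>UNIV. I i \<omega>)))"

definition semigroup_op ::
    "'w measure \<Rightarrow> (real^'d::finite \<Rightarrow> real \<Rightarrow> 'w \<Rightarrow> real^'d) \<Rightarrow> real \<Rightarrow> (real^'d \<Rightarrow> real) \<Rightarrow>
     real^'d \<Rightarrow> real" where
  "semigroup_op M X t f x = (\<integral>\<omega>. f (X x t \<omega>) \<partial>M)"

definition em_step ::
    "(real^'d::finite \<Rightarrow> real^'d) \<Rightarrow> ('d \<Rightarrow> real^'d \<Rightarrow> real^'d) \<Rightarrow> real \<Rightarrow> real^'d \<Rightarrow> real^'d \<Rightarrow>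
     real^'d" where
  "em_step b \<sigma> t x w = x + t *\<^sub>R b x + (\<Sum>i\<in>UNIV. (w $ i) *\<^sub>R \<sigma> i x)"

text \<open>\<open>euler_maruyama W b \<sigma> T n x0 k\<close> is the scheme at time \<open>k * T / n\<close>.\<close>

primrec euler_maruyama ::
    "(real \<Rightarrow> 'w \<Rightarrow> real^'d::finite) \<Rightarrow> (real^'d \<Rightarrow> real^'d) \<Rightarrow> ('d \<Rightarrow> real^'d \<Rightarrow> real^'d) \<Rightarrow>
     real \<Rightarrow> nat \<Rightarrow> real^'d \<Rightarrow> nat \<Rightarrow> 'w \<Rightarrow> real^'d" where
  "euler_maruyama W b \<sigma> T n x0 0 \<omega> = x0"
| "euler_maruyama W b \<sigma> T n x0 (Suc k) \<omega> =
     em_step b \<sigma> (T / real n) (euler_maruyama W b \<sigma> T n x0 k \<omega>)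
       (W (real (Suc k) * T / real n) \<omega> - W (real k * T / real n) \<omega>)"

definition weak_approx_op ::
    "'w measure \<Rightarrow> (real \<Rightarrow> 'w \<Rightarrow> real^'d::finite) \<Rightarrow> (real^'d \<Rightarrow> real^'d) \<Rightarrow>
     ('d \<Rightarrow> real^'d \<Rightarrow> real^'d) \<Rightarrow> (real \<Rightarrow> real^'d \<Rightarrow> real^'d \<Rightarrow> real) \<Rightarrow> real \<Rightarrow>
     (real^'d \<Rightarrow> real) \<Rightarrow> real^'d \<Rightarrow> real" where
  "weak_approx_op M W b \<sigma> wt t f x =
     (\<integral>\<omega>. f (em_step b \<sigma> t x (W t \<omega>)) * wt t x (W t \<omega>) \<partial>M)"

definition poly_growth :: "(real^'d::finite \<Rightarrow> real) \<Rightarrow> bool" where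
  "poly_growth c \<longleftrightarrow> (\<exists>C (k::nat). \<forall>x. \<bar>c x\<bar> \<le> C * (1 + norm x) ^ k)"

text \<open>\<open>A\<close> is the finite set of multi-indices of the monomials that occur.\<close>

definition poly_weight :: "(real^'d::finite \<Rightarrow> real^'d \<Rightarrow> real) \<Rightarrow> bool" where
  "poly_weight p \<longleftrightarrow>
     (\<exists>(A :: ('d \<Rightarrow> nat) set) c. finite A \<and>
        (\<forall>\<alpha>\<in>A. continuous_on UNIV (c \<alpha>) \<and> poly_growth (c \<alpha>)) \<and>
        (\<forall>x w. p x w = (\<Sum>\<alpha>\<in>A. c \<alpha> x * (\<Prod>i\<in>UNIV. (w $ i) ^ \<alpha> i))))"

text \<open>The last clause is the local error bound of order \<open>m + 1\<close> in supremum norm as the step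
  size tends to 0.\<close>

definition malliavin_weight ::
    "'w measure \<Rightarrow> (real \<Rightarrow> 'w \<Rightarrow> real^'d::finite) \<Rightarrow> (real^'d \<Rightarrow> real^'d) \<Rightarrow>
     ('d \<Rightarrow> real^'d \<Rightarrow> real^'d) \<Rightarrow> (real^'d \<Rightarrow> real \<Rightarrow> 'w \<Rightarrow> real^'d) \<Rightarrow> nat \<Rightarrow>
     (real \<Rightarrow> real^'d \<Rightarrow> real^'d \<Rightarrow> real) \<Rightarrow> bool" where
  "malliavin_weight M W b \<sigma> X m wt \<longleftrightarrow>
     (\<forall>t>0. poly_weight (wt t)) \<and>
     (m = 1 \<longrightarrow> (\<forall>t>0. \<forall>x w. wt t x w = 1)) \<and>
     (\<forall>f\<in>Cb_inf. \<exists>C. \<forall>\<^sub>F t in at_right 0. \<forall>x.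
        \<bar>semigroup_op M X t f x - weak_approx_op M W b \<sigma> wt t f x\<bar> \<le> C * t ^ (m + 1))"

end

theory Submission
  imports Defs
begin

text \<open>The mean square loss is minimized exactly at the expectation of the weighted terminal
  value, which lies in \<open>L\<^sup>2\<close> because all moments of the scheme and of the weights are finite.
  That expectation is evaluated by peeling off one time step at a time: the last Brownian increment
  is independent of the state and of the weights accumulated before it, so integrating it out
  replaces the test function \<open>g\<close> by its image under the one-step operator. Measurability and
  polynomial growth of \<open>g\<close> are preserved.\<close>

section \<open>Minimizing the mean square loss\<close>

lemma is_arg_min_mean_square_iff:
  fixes Y :: "'w \<Rightarrow> real"
  assumes "prob_space M" and Y: "integrable M Y" and Y2: "integrable M (\<lambda>\<omega>. (Y \<omega>)\<^sup>2)"
  shows "is_arg_min (\<lambda>v. \<integral>\<omega>. \<bar>v - Y \<omega>\<bar>\<^sup>2 \<partial>M) (\<lambda>_. True) v \<longleftrightarrow> v = (\<integral>\<omega>. Y \<omega> \<partial>M)"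
proof -
  interpret prob_space M by fact
  let ?e = "\<integral>\<omega>. Y \<omega> \<partial>M"
  \<comment> \<open>Bias-variance decomposition: the loss is the squared distance of
    \<open>u\<close> from the mean plus the variance of \<open>Y\<close>, and the latter does not
    depend on \<open>u\<close>.\<close>
  have loss: "(\<integral>\<omega>. \<bar>u - Y \<omega>\<bar>\<^sup>2 \<partial>M) = (u - ?e)\<^sup>2 + ((\<integral>\<omega>. (Y \<omega>)\<^sup>2 \<partial>M) - ?e\<^sup>2)" for u
  proof -
    have "(\<integral>\<omega>. \<bar>u - Y \<omega>\<bar>\<^sup>2 \<partial>M) = (\<integral>\<omega>. u\<^sup>2 - 2 * u * Y \<omega> + (Y \<omega>)\<^sup>2 \<partial>M)"
      by (simp add: power2_diff algebra_simps)
    also have "\<dots> = u\<^sup>2 - 2 * u * ?e + (\<integral>\<omega>. (Y \<omega>)\<^sup>2 \<partial>M)"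
      using Y Y2 by (simp add: prob_space)
    finally show ?thesis by (simp add: power2_diff algebra_simps)
  qed
  have "(\<forall>y. (v - ?e)\<^sup>2 \<le> (y - ?e)\<^sup>2) \<longleftrightarrow> v = ?e"
  proof
    assume "\<forall>y. (v - ?e)\<^sup>2 \<le> (y - ?e)\<^sup>2"
    from spec[OF this, of ?e] show "v = ?e" by simp
  qed simp
  then show ?thesis unfolding is_arg_min_linorder loss by simp
qed

section \<open>Integrating out an independent variable\<close>

text \<open>Independence makes the joint law a product, so Fubini integrates over \<open>D\<close>
  first with \<open>Z\<close> frozen. The inner integral plays the part of the conditional
  expectation given \<open>Z\<close>.\<close>

lemma (in prob_space) indep_var_integral_decouple:
  fixes h :: "'b \<times> 'b \<Rightarrow> real"
  assumes ind: "indep_var S Z R D" and h: "h \<in> borel_measurable (S \<Otimes>\<^sub>M R)"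
    and int: "integrable M (\<lambda>\<omega>. h (Z \<omega>, D \<omega>))"
  shows "(\<integral>\<omega>. h (Z \<omega>, D \<omega>) \<partial>M) = (\<integral>\<omega>. (\<integral>\<omega>'. h (Z \<omega>, D \<omega>') \<partial>M) \<partial>M)"
proof -
  have Z[measurable]: "Z \<in> measurable M S" and D[measurable]: "D \<in> measurable M R"
    and eq: "distr M S Z \<Otimes>\<^sub>M distr M R D = distr M (S \<Otimes>\<^sub>M R) (\<lambda>\<omega>. (Z \<omega>, D \<omega>))"
    using ind unfolding indep_var_distribution_eq by auto
  note h[measurable]
  interpret Z: prob_space "distr M S Z" by (rule prob_space_distr) fact
  interpret D: prob_space "distr M R D" by (rule prob_space_distr) fact
  interpret P: pair_sigma_finite "distr M S Z" "distr M R D" ..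
  have "integrable (distr M S Z \<Otimes>\<^sub>M distr M R D) h"
    unfolding eq using int by (subst integrable_distr_eq) simp_all
  then have "(\<integral>z. (\<integral>d. h (z, d) \<partial>distr M R D) \<partial>distr M S Z)
      = integral\<^sup>L (distr M S Z \<Otimes>\<^sub>M distr M R D) h"
    by (rule P.integral_fst')
  also have "\<dots> = (\<integral>\<omega>. h (Z \<omega>, D \<omega>) \<partial>M)"
    unfolding eq by (rule integral_distr) simp_all
  also have "(\<integral>z. (\<integral>d. h (z, d) \<partial>distr M R D) \<partial>distr M S Z)
      = (\<integral>\<omega>. (\<integral>d. h (Z \<omega>, d) \<partial>distr M R D) \<partial>M)"
    by (rule integral_distr) simp_all
  also have "\<dots> = (\<integral>\<omega>. (\<integral>\<omega>'. h (Z \<omega>, D \<omega>') \<partial>M) \<partial>M)"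
  \<comment> \<open>Measurability of the section of \<open>h\<close> at \<open>Z \<omega>\<close>
    rests on \<open>Z \<omega>\<close> lying in \<open>space S\<close>, hence the congruence over
    \<open>space M\<close>.\<close>
  proof (rule Bochner_Integration.integral_cong[OF refl])
    fix \<omega> assume "\<omega> \<in> space M"
    then have "Z \<omega> \<in> space S" by (rule measurable_space[OF Z])
    then show "(\<integral>d. h (Z \<omega>, d) \<partial>distr M R D) = (\<integral>\<omega>'. h (Z \<omega>, D \<omega>') \<partial>M)"
      by (intro integral_distr) simp_all
  qed
  finally show ?thesis by simp
qed

section \<open>Moments of Gaussian vectors\<close>

text \<open>Multiplied out, the product contains 1, every \<open>\<bar>w $ i\<bar>\<close> and
  further nonnegative terms, and the l1 norm dominates the Euclidean norm. The bound factorizes over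
  coordinates, as the Gaussian density does.\<close>

lemma one_plus_norm_le_prod:
  fixes w :: "real^'d::finite"
  shows "1 + norm w \<le> (\<Prod>i\<in>UNIV. 1 + \<bar>w $ i\<bar>)"
proof -
  have "1 + (\<Sum>i\<in>A. \<bar>w $ i\<bar>) \<le> (\<Prod>i\<in>A. 1 + \<bar>w $ i\<bar>)" for A
  proof (induction A rule: infinite_finite_induct)
    case (insert i A)
    have "1 \<le> (\<Prod>i\<in>A. 1 + \<bar>w $ i\<bar>)" by (rule prod_ge_1) simp
    then have "\<bar>w $ i\<bar> \<le> \<bar>w $ i\<bar> * (\<Prod>i\<in>A. 1 + \<bar>w $ i\<bar>)"
      using mult_left_mono[of 1 "\<Prod>i\<in>A. 1 + \<bar>w $ i\<bar>" "\<bar>w $ i\<bar>"] by simp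
    with insert show ?case by (simp add: algebra_simps)
  qed simp_all
  moreover have "norm w \<le> (\<Sum>i\<in>UNIV. \<bar>w $ i\<bar>)" by (rule norm_le_l1_cart)
  ultimately show ?thesis by (meson add_left_mono order_trans)
qed

text \<open>By Tonelli the integral is a product of one-dimensional integrals, each of them
  finite.\<close>

lemma integrable_lborel_prod_nth:
  fixes g :: "'d::finite \<Rightarrow> real \<Rightarrow> real"
  assumes "\<And>i. integrable lborel (g i)" and nn: "\<And>i x. 0 \<le> g i x"
  shows "integrable lborel (\<lambda>w::real^'d. \<Prod>i\<in>UNIV. g i (w $ i))"
proof (rule integrableI_nonneg)
  have [measurable]: "g i \<in> borel_measurable borel" for i
    using borel_measurable_integrable[OF assms(1)[of i]] by simp
  show "(\<lambda>w::real^'d. \<Prod>i\<in>UNIV. g i (w $ i)) \<in> borel_measurable lborel" by simp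
  show "AE w::real^'d in lborel. 0 \<le> (\<Prod>i\<in>UNIV. g i (w $ i))" by (simp add: nn prod_nonneg)
  \<comment> \<open>\<open>lborel\<close> factorizes over \<open>Basis\<close> and inner products,
    the integrand over indices and coordinates. The next facts translate between the two,
    \<open>axis i 1\<close> being the basis vector of index \<open>i\<close>.\<close>
  have axis_index: "axis_index (axis i 1 :: real^'d) = i" for i
    by (metis axis_eq_axis axis_in_Basis_iff axis_index inner_Basis one_neq_zero Basis_real_def singletonI)
  have bij: "bij_betw (\<lambda>i. axis i 1 :: real^'d) UNIV Basis"
    by (auto simp: bij_betw_def inj_on_def axis_eq_axis Basis_vec_def)
  have reindex: "(\<Prod>i\<in>UNIV. F i) = (\<Prod>b\<in>(Basis :: (real^'d) set). F (axis_index b))"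
    for F :: "'d \<Rightarrow> ennreal"
    using prod.reindex_bij_betw[OF bij, of "\<lambda>b. F (axis_index b)"] by (simp add: axis_index)
  have nth: "w $ axis_index b = w \<bullet> b" if "b \<in> Basis" for w b :: "real^'d"
    using axis_index[of "axis_index b"] that
    by (metis axis_inverse cart_eq_inner_axis axis_index)
  have "(\<integral>\<^sup>+w. ennreal (\<Prod>i\<in>UNIV. g i ((w::real^'d) $ i)) \<partial>lborel)
      = (\<integral>\<^sup>+w. (\<Prod>b\<in>Basis. ennreal (g (axis_index b) ((w::real^'d) \<bullet> b))) \<partial>lborel)"
    by (simp add: prod_ennreal[symmetric] nn reindex nth del: prod_ennreal cong: prod.cong)
  also have "\<dots> = (\<Prod>b\<in>(Basis :: (real^'d) set). \<integral>\<^sup>+x. ennreal (g (axis_index b) x) \<partial>lborel)"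
    by (rule nn_integral_lborel_prod) simp_all
  also have "\<dots> = (\<Prod>i\<in>UNIV. \<integral>\<^sup>+x. ennreal (g i x) \<partial>lborel)"
    by (rule reindex[symmetric])
  also have "\<dots> < \<infinity>"
    using assms by (auto simp: less_top[symmetric] ennreal_prod_eq_top
      nn_integral_eq_integral)
  finally show "(\<integral>\<^sup>+w. ennreal (\<Prod>i\<in>UNIV. g i ((w::real^'d) $ i)) \<partial>lborel) < \<infinity>" .
qed

text \<open>The binomial expansion reduces the claim to absolute moments of the normal law; writing
  \<open>x - 0\<close> matches central moments about the mean 0.\<close>

lemma integrable_normal_density_power:
  assumes "0 < s"
  shows "integrable lborel (\<lambda>x. normal_density 0 s x * (1 + \<bar>x\<bar>) ^ p)"
proof -
  have "integrable lborel
      (\<lambda>x. \<Sum>k\<le>p. real (p choose k) * (normal_density 0 s x * \<bar>x - 0\<bar> ^ k))"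
    using integrable_normal_moment_abs[OF assms, of 0] by (intro Bochner_Integration.integrable_sum
      integrable_mult_right) auto
  also have "(\<lambda>x. \<Sum>k\<le>p. real (p choose k) * (normal_density 0 s x * \<bar>x - 0\<bar> ^ k))
      = (\<lambda>x. normal_density 0 s x * (1 + \<bar>x\<bar>) ^ p)"
  proof
    fix x :: real
    have "(1 + \<bar>x\<bar>) ^ p = (\<Sum>k\<le>p. real (p choose k) * \<bar>x\<bar> ^ k)"
      using binomial_ring[of "\<bar>x\<bar>" 1 p] by (simp add: add.commute)
    then show "(\<Sum>k\<le>p. real (p choose k) * (normal_density 0 s x * \<bar>x - 0\<bar> ^ k))
      = normal_density 0 s x * (1 + \<bar>x\<bar>) ^ p"
      by (simp add: sum_distrib_left mult_ac)
  qed
  finally show ?thesis .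
qed

text \<open>Replacing \<open>1 + norm y\<close> by a product over coordinates turns density times
  power into a product of one-dimensional integrands.\<close>

lemma gaussian_integrable_power:
  fixes Z :: "'w \<Rightarrow> real^'d::finite"
  assumes "0 < s"
    and dist: "distributed M lborel Z
      (\<lambda>y. ennreal (\<Prod>i\<in>UNIV. normal_density 0 s (y $ i)))"
  shows "integrable M (\<lambda>\<omega>. (1 + norm (Z \<omega>)) ^ p)"
proof -
  have "integrable lborel
      (\<lambda>y::real^'d. \<Prod>i\<in>UNIV. normal_density 0 s (y $ i) * (1 + \<bar>y $ i\<bar>) ^ p)"
    by (rule integrable_lborel_prod_nth) (simp_all add: integrable_normal_density_power assms)
  then have "integrable lborel
      (\<lambda>y::real^'d. (\<Prod>i\<in>UNIV. normal_density 0 s (y $ i)) * (1 + norm y) ^ p)"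
  proof (rule Bochner_Integration.integrable_bound)
    show "AE y::real^'d in lborel. norm ((\<Prod>i\<in>UNIV. normal_density 0 s (y $ i)) * (1 + norm y) ^ p)
        \<le> norm (\<Prod>i\<in>UNIV. normal_density 0 s (y $ i) * (1 + \<bar>y $ i\<bar>) ^ p)"
    proof (rule AE_I2)
      fix y :: "real^'d"
      have "(1 + norm y) ^ p \<le> (\<Prod>i\<in>UNIV. 1 + \<bar>y $ i\<bar>) ^ p"
        by (intro power_mono one_plus_norm_le_prod) simp
      then show "norm ((\<Prod>i\<in>UNIV. normal_density 0 s (y $ i)) * (1 + norm y) ^ p)
        \<le> norm (\<Prod>i\<in>UNIV. normal_density 0 s (y $ i) * (1 + \<bar>y $ i\<bar>) ^ p)"
        by (auto simp: prod.distrib abs_mult prod_nonneg prod_power_distrib intro!: mult_left_mono)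
    qed
  qed simp
  then show ?thesis
    by (subst (asm) distributed_integrable[OF dist]) (simp_all add: prod_nonneg)
qed

section \<open>Growth and measurability of test functions, weights and the one-step map\<close>

lemma lipschitz_poly_growth:
  fixes f :: "real^'d::finite \<Rightarrow> real"
  assumes "L-lipschitz_on UNIV f"
  shows "poly_growth f"
  unfolding poly_growth_def
proof (intro exI allI)
  fix x
  have "\<bar>f x - f 0\<bar> \<le> L * norm x"
    using lipschitz_onD[OF assms, of x 0] by (simp add: dist_norm)
  moreover have "0 \<le> L" by (rule lipschitz_on_nonneg[OF assms])
  moreover have "0 \<le> \<bar>f 0\<bar> * norm x" by simp
  moreover have "(\<bar>f 0\<bar> + L) * (1 + norm x) ^ 1 = \<bar>f 0\<bar> + \<bar>f 0\<bar> * norm x + L + L * norm x"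
    by (simp add: algebra_simps)
  ultimately show "\<bar>f x\<bar> \<le> (\<bar>f 0\<bar> + L) * (1 + norm x) ^ 1"
    by linarith
qed

lemma Cb_inf_continuous_bounded:
  assumes "g \<in> Cb_inf"
  shows "continuous_on UNIV g" and "bounded (range g)"
proof -
  \<comment> \<open>The empty list of partial derivatives stands for \<open>g\<close>
    itself.\<close>
  have "(\<forall>x. iter_partial [] g differentiable (at x)) \<and> bounded (range (iter_partial [] g))"
    using assms unfolding Cb_inf_def by blast
  then show "continuous_on UNIV g" "bounded (range g)"
    by (auto simp: continuous_on_eq_continuous_at intro: differentiable_imp_continuous_within)
qed

text \<open>A single base \<open>?B\<close>, which is at least 1, dominates all monomials and
  coefficients. Its product form later lets independence separate the state from the
  increment.\<close>

lemma poly_weight_growth: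
  fixes p :: "real^'d::finite \<Rightarrow> real^'d \<Rightarrow> real"
  assumes "poly_weight p"
  shows "\<exists>K a. \<forall>x w. \<bar>p x w\<bar> \<le> K * ((1 + norm x) * (1 + norm w)) ^ a"
proof -
  let ?B = "\<lambda>x w. (1 + norm (x::real^'d)) * (1 + norm (w::real^'d))"
  have B1: "1 \<le> ?B x w" for x w
    using mult_mono[of 1 "1 + norm x" 1 "1 + norm w"] by simp
  have Bge: "1 + norm x \<le> ?B x w" "1 + norm w \<le> ?B x w" for x w
    by (simp_all add: algebra_simps)
  obtain A :: "('d \<Rightarrow> nat) set" and c where A: "finite A"
    and c: "\<And>\<alpha>. \<alpha> \<in> A \<Longrightarrow> poly_growth (c \<alpha>)"
    and p: "\<And>x w. p x w = (\<Sum>\<alpha>\<in>A. c \<alpha> x * (\<Prod>i\<in>UNIV. (w $ i) ^ \<alpha> i))"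
    using assms unfolding poly_weight_def by auto
  \<comment> \<open>The induction runs over subsets of \<open>A\<close>, because growth is known
    only for coefficients with index in \<open>A\<close>.\<close>
  have "\<exists>K a. \<forall>x w. \<bar>\<Sum>\<alpha>\<in>B. c \<alpha> x * (\<Prod>i\<in>UNIV. (w $ i) ^ \<alpha> i)\<bar> \<le> K * ?B x w ^ a"
    if "finite B" "B \<subseteq> A" for B
    using that
  proof (induction B rule: finite_induct)
    case empty
    show ?case by (rule exI[of _ 0]) simp
  next
    case (insert \<alpha> B)
    obtain K a where K: "\<bar>\<Sum>\<alpha>\<in>B. c \<alpha> x * (\<Prod>i\<in>UNIV. (w $ i) ^ \<alpha> i)\<bar> \<le> K * ?B x w ^ a" for x w
      using insert by auto
    obtain C k where C: "\<bar>c \<alpha> x\<bar> \<le> C * (1 + norm x) ^ k" for x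
      using c[of \<alpha>] insert.prems unfolding poly_growth_def by auto
    \<comment> \<open>The total degree of the monomial; each coordinate is at most
      \<open>1 + norm w\<close> in absolute value.\<close>
    define l where "l = (\<Sum>i\<in>UNIV. \<alpha> i)"
    have C0: "0 \<le> C"
      using order_trans[OF abs_ge_zero C[of 0]] by simp
    have K0: "0 \<le> K"
      using order_trans[OF abs_ge_zero K[of 0 0]] by simp
    have monom: "\<bar>\<Prod>i\<in>UNIV. (w $ i) ^ \<alpha> i\<bar> \<le> (1 + norm w) ^ l" for w :: "real^'d"
    proof -
      have "\<bar>\<Prod>i\<in>UNIV. (w $ i) ^ \<alpha> i\<bar> = (\<Prod>i\<in>UNIV. \<bar>w $ i\<bar> ^ \<alpha> i)"
        by (simp add: abs_prod power_abs)
      also have "\<dots> \<le> (\<Prod>i\<in>UNIV. (1 + norm w) ^ \<alpha> i)"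
      proof (intro prod_mono conjI power_mono)
        fix i show "\<bar>w $ i\<bar> \<le> 1 + norm w"
          using component_le_norm_cart[of w i] by linarith
      qed simp_all
      also have "\<dots> = (1 + norm w) ^ l" by (simp add: l_def power_sum)
      finally show ?thesis .
    qed
    \<comment> \<open>As \<open>?B\<close> is at least 1, the sum of all exponents is a common
      exponent for the new monomial and the old sum.\<close>
    have "\<bar>\<Sum>\<beta>\<in>insert \<alpha> B. c \<beta> x * (\<Prod>i\<in>UNIV. (w $ i) ^ \<beta> i)\<bar>
        \<le> (C + K) * ?B x w ^ (k + l + a)" for x w
    proof -
      have "\<bar>c \<alpha> x * (\<Prod>i\<in>UNIV. (w $ i) ^ \<alpha> i)\<bar> \<le> (C * (1 + norm x) ^ k) * (1 + norm w) ^ l"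
        unfolding abs_mult by (intro mult_mono C monom) (simp_all add: C0)
      also have "\<dots> \<le> (C * ?B x w ^ k) * ?B x w ^ l"
        using C0 by (intro mult_mono power_mono mult_left_mono Bge mult_nonneg_nonneg) simp_all
      also have "\<dots> = C * ?B x w ^ (k + l)" by (simp add: power_add)
      also have "\<dots> \<le> C * ?B x w ^ (k + l + a)"
        using B1[of x w] C0 by (intro mult_left_mono power_increasing) auto
      finally have 1: "\<bar>c \<alpha> x * (\<Prod>i\<in>UNIV. (w $ i) ^ \<alpha> i)\<bar> \<le> C * ?B x w ^ (k + l + a)" .
      have "K * ?B x w ^ a \<le> K * ?B x w ^ (k + l + a)"
        using B1[of x w] K0 by (intro mult_left_mono power_increasing) auto
      with K[of x w] 1 insert.hyps show ?thesis
        by (simp add: distrib_right)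
    qed
    then show ?case by blast
  qed
  from this[OF A order_refl] show ?thesis unfolding p .
qed

lemma snd_nth_measurable [measurable]:
  "(\<lambda>z. snd z $ i) \<in> borel_measurable (M \<Otimes>\<^sub>M (borel :: (real^'d::finite) measure))"
  by (rule measurable_compose[OF measurable_snd])
    (intro borel_measurable_continuous_onI continuous_intros)

lemma poly_weight_measurable:
  fixes p :: "real^'d::finite \<Rightarrow> real^'d \<Rightarrow> real"
  assumes "poly_weight p"
  shows "(\<lambda>(x, w). p x w) \<in> borel_measurable (borel \<Otimes>\<^sub>M borel)"
proof -
  obtain A :: "('d \<Rightarrow> nat) set" and c where
    c: "\<And>\<alpha>. \<alpha> \<in> A \<Longrightarrow> c \<alpha> \<in> borel_measurable borel"
    and p: "\<And>x w. p x w = (\<Sum>\<alpha>\<in>A. c \<alpha> x * (\<Prod>i\<in>UNIV. (w $ i) ^ \<alpha> i))"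
    using assms unfolding poly_weight_def by (auto intro: borel_measurable_continuous_onI)
  have "(\<lambda>z. c \<alpha> (fst z)) \<in> borel_measurable (borel \<Otimes>\<^sub>M (borel :: (real^'d) measure))" if "\<alpha> \<in> A" for \<alpha>
    by (rule measurable_compose[OF measurable_fst c[OF that]])
  then show ?thesis
    unfolding p split_beta' by measurable
qed

lemma em_step_measurable:
  assumes "b \<in> borel_measurable borel" and "\<And>i. \<sigma> i \<in> borel_measurable borel"
  shows "(\<lambda>(x, w). em_step b \<sigma> t x w) \<in> borel_measurable (borel \<Otimes>\<^sub>M borel)"
proof -
  note assms(1)[measurable]
  have [measurable]: "(\<lambda>z. \<sigma> i (fst z)) \<in> borel_measurable (borel \<Otimes>\<^sub>M borel)" for i
    by (rule measurable_compose[OF measurable_fst assms(2)])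
  show ?thesis unfolding em_step_def split_beta' by measurable
qed

text \<open>With bounded coefficients the step grows at most linearly in the state and in the
  increment; the product absorbs both. The constant may depend on \<open>t\<close>, which is
  fixed.\<close>

lemma em_step_growth:
  fixes b :: "real^'d::finite \<Rightarrow> real^'d"
  assumes "bounded (range b)" and "\<And>i. bounded (range (\<sigma> i))"
  shows "\<exists>C. \<forall>x w. 1 + norm (em_step b \<sigma> t x w) \<le> C * ((1 + norm x) * (1 + norm w))"
proof -
  obtain B where B: "norm (b x) \<le> B" for x
    using assms(1) by (auto simp: bounded_iff)
  have "\<exists>S. \<forall>i x. norm (\<sigma> i x) \<le> S i"
    using assms(2) by (intro choice allI) (auto simp: bounded_iff)
  then obtain S where S: "norm (\<sigma> i x) \<le> S i" for i x
    by auto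
  have B0: "0 \<le> B" using order_trans[OF norm_ge_zero B] .
  have S0: "0 \<le> S i" for i using order_trans[OF norm_ge_zero S] .
  have Ss: "0 \<le> (\<Sum>i\<in>UNIV. S i)" by (intro sum_nonneg S0)
  show ?thesis
  proof (intro exI allI)
    fix x w :: "real^'d"
    have "norm (\<Sum>i\<in>UNIV. (w $ i) *\<^sub>R \<sigma> i x) \<le> (\<Sum>i\<in>UNIV. norm w * S i)"
      by (intro order_trans[OF norm_sum] sum_mono)
        (auto intro!: mult_mono S component_le_norm_cart)
    then have sum: "norm (\<Sum>i\<in>UNIV. (w $ i) *\<^sub>R \<sigma> i x) \<le> norm w * (\<Sum>i\<in>UNIV. S i)"
      by (simp add: sum_distrib_left)
    have drift: "norm (t *\<^sub>R b x) \<le> \<bar>t\<bar> * B"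
      by (auto intro: mult_left_mono B)
    have "1 + norm (em_step b \<sigma> t x w) \<le> 1 + norm x + \<bar>t\<bar> * B + norm w * (\<Sum>i\<in>UNIV. S i)"
      unfolding em_step_def
      using norm_triangle_ineq[of "x + t *\<^sub>R b x" "\<Sum>i\<in>UNIV. (w $ i) *\<^sub>R \<sigma> i x"]
        norm_triangle_ineq[of x "t *\<^sub>R b x"] sum drift by linarith
    also have "\<dots> \<le> (1 + \<bar>t\<bar> * B + (\<Sum>i\<in>UNIV. S i)) * ((1 + norm x) * (1 + norm w))"
    proof -
      have ge: "1 + norm x \<le> (1 + norm x) * (1 + norm w)" "1 \<le> (1 + norm x) * (1 + norm w)"
        "norm w \<le> (1 + norm x) * (1 + norm w)"
        by (simp_all add: algebra_simps)
      have "\<bar>t\<bar> * B \<le> (\<bar>t\<bar> * B) * ((1 + norm x) * (1 + norm w))"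
        using mult_left_mono[OF ge(2), of "\<bar>t\<bar> * B"] B0 by simp
      moreover have "norm w * (\<Sum>i\<in>UNIV. S i) \<le> (\<Sum>i\<in>UNIV. S i) * ((1 + norm x) * (1 + norm w))"
        using mult_left_mono[OF ge(3) Ss] by (simp add: mult.commute)
      ultimately show ?thesis
        using ge(1) by (simp add: distrib_right[of _ _ "(1 + norm x) * (1 + norm w)"])
    qed
    finally show "1 + norm (em_step b \<sigma> t x w)
      \<le> (1 + \<bar>t\<bar> * B + (\<Sum>i\<in>UNIV. S i)) * ((1 + norm x) * (1 + norm w))" .
  qed
qed

section \<open>The weighted chain as a function of the increments\<close>

text \<open>The state is paired with the product of the weights collected so far, each evaluated at
  the state before its step. Being a deterministic function of the increments, the pair inherits
  independence from them by composition.\<close>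

primrec weighted_chain ::
    "('x \<Rightarrow> 'a \<Rightarrow> 'x) \<Rightarrow> ('x \<Rightarrow> 'a \<Rightarrow> real) \<Rightarrow> 'x \<Rightarrow> (nat \<Rightarrow> 'a) \<Rightarrow> nat \<Rightarrow> 'x \<times> real" where
  "weighted_chain S q x0 w 0 = (x0, 1)"
| "weighted_chain S q x0 w (Suc k) =
     (S (fst (weighted_chain S q x0 w k)) (w k),
      snd (weighted_chain S q x0 w k) * q (fst (weighted_chain S q x0 w k)) (w k))"

text \<open>The first \<open>k\<close> steps read only \<open>w 0\<close> to
  \<open>w (k - 1)\<close>. Independence of blocks speaks of restricted families, hence this
  form.\<close>

lemma weighted_chain_restrict:
  "k \<le> N \<Longrightarrow> weighted_chain S q x0 (restrict w {..<N}) k = weighted_chain S q x0 w k"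
  by (induction k) simp_all

text \<open>Keeping \<open>N\<close> apart from \<open>k\<close> lets the induction on
  \<open>k\<close> stay on one product space.\<close>

lemma weighted_chain_measurable:
  fixes S :: "'x::second_countable_topology \<Rightarrow> 'a::second_countable_topology \<Rightarrow> 'x"
  assumes S[measurable]: "(\<lambda>(x, w). S x w) \<in> borel_measurable (borel \<Otimes>\<^sub>M borel)"
    and q[measurable]: "(\<lambda>(x, w). q x w) \<in> borel_measurable (borel \<Otimes>\<^sub>M borel)"
    and "k \<le> N"
  shows "(\<lambda>w. weighted_chain S q x0 w k)
    \<in> measurable (\<Pi>\<^sub>M i\<in>{..<N}. borel) (borel \<Otimes>\<^sub>M borel)"
  using \<open>k \<le> N\<close>
proof (induction k)
  case (Suc k)
  then have [measurable]: "(\<lambda>w. weighted_chain S q x0 w k)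
      \<in> measurable (\<Pi>\<^sub>M i\<in>{..<N}. borel) (borel \<Otimes>\<^sub>M borel)"
    and "k \<in> {..<N}" by simp_all
  then have [measurable]: "(\<lambda>w. w k) \<in> measurable (\<Pi>\<^sub>M i\<in>{..<N}. borel) borel"
    by (intro measurable_component_singleton)
  show ?case unfolding weighted_chain.simps by measurable
qed simp

section \<open>The recursion driven by independent, identically distributed increments\<close>

text \<open>An abstraction of the scheme: \<open>S\<close> is the one-step map, \<open>q\<close> the
  weight and \<open>G\<close> the common law of the increments. Both growth bounds are products, so
  moments of state and increment can be treated separately.\<close>

locale weighted_recursion = prob_space M for M :: "'w measure" +
  fixes D :: "nat \<Rightarrow> 'w \<Rightarrow> real^'d::finite" and n :: nat and G :: "(real^'d) measure"
    and S :: "real^'d \<Rightarrow> real^'d \<Rightarrow> real^'d" and q :: "real^'d \<Rightarrow> real^'d \<Rightarrow> real"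
    and x0 :: "real^'d" and C K :: real and a :: nat
  assumes indep: "indep_vars (\<lambda>_. borel) D {..<n}"
    and law: "k < n \<Longrightarrow> distr M borel (D k) = G"
    and moments: "integrable G (\<lambda>w. (1 + norm w) ^ p)"
    and sets_G[measurable_cong]: "sets G = sets borel"
    and S_measurable[measurable]: "(\<lambda>(x, w). S x w) \<in> borel_measurable (borel \<Otimes>\<^sub>M borel)"
    and q_measurable[measurable]: "(\<lambda>(x, w). q x w) \<in> borel_measurable (borel \<Otimes>\<^sub>M borel)"
    and S_growth: "1 + norm (S x w) \<le> C * ((1 + norm x) * (1 + norm w))"
    and q_growth: "\<bar>q x w\<bar> \<le> K * ((1 + norm x) * (1 + norm w)) ^ a"
begin

text \<open>The one-step operator, integrated against the common law so that one operator serves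
  every step.\<close>

definition Q :: "(real^'d \<Rightarrow> real) \<Rightarrow> real^'d \<Rightarrow> real" where
  "Q g x = (\<integral>w. g (S x w) * q x w \<partial>G)"

definition Z :: "nat \<Rightarrow> 'w \<Rightarrow> (real^'d) \<times> real" where
  "Z k \<omega> = weighted_chain S q x0 (\<lambda>i. D i \<omega>) k"

lemma Z_simps:
  "Z 0 \<omega> = (x0, 1)"
  "Z (Suc k) \<omega> = (S (fst (Z k \<omega>)) (D k \<omega>), snd (Z k \<omega>) * q (fst (Z k \<omega>)) (D k \<omega>))"
  by (simp_all add: Z_def)

lemma C_nonneg: "0 \<le> C"
  using order_trans[OF _ S_growth[of 0 0], of 0] by simp

lemma K_nonneg: "0 \<le> K"
  using order_trans[OF abs_ge_zero q_growth[of 0 0]] by simp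

lemma D_measurable: "k < n \<Longrightarrow> D k \<in> borel_measurable M"
  using indep by (auto simp: indep_vars_def)

lemma D_moments:
  assumes "k < n" shows "integrable M (\<lambda>\<omega>. (1 + norm (D k \<omega>)) ^ p)"
  using moments[of p] D_measurable[OF assms]
  by (subst (asm) law[OF assms, symmetric], subst (asm) integrable_distr_eq) simp_all

text \<open>\<^const>\<open>indep_var\<close> relates variables of equal type only, hence the padding of \<open>D k\<close> with 0.\<close>

lemma indep_Z_D:
  assumes "k < n"
  shows "indep_var (borel \<Otimes>\<^sub>M borel) (Z k) (borel \<Otimes>\<^sub>M borel) (\<lambda>\<omega>. (D k \<omega>, 0 :: real))"
proof -
  \<comment> \<open>The increments before \<open>k\<close> and the increment \<open>k\<close> form
    disjoint blocks of an independent family; \<open>Z k\<close> is a function of the first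
    block.\<close>
  have ind: "indep_var (\<Pi>\<^sub>M i\<in>{..<k}. borel) (\<lambda>\<omega>. \<lambda>i\<in>{..<k}. D i \<omega>)
      (\<Pi>\<^sub>M i\<in>{k}. borel) (\<lambda>\<omega>. \<lambda>i\<in>{k}. D i \<omega>)"
    by (rule indep_var_restrict[OF indep]) (use assms in auto)
  have "(\<lambda>w. (w k, 0 :: real)) \<in> measurable (\<Pi>\<^sub>M i\<in>{k}. borel) (borel \<Otimes>\<^sub>M borel)"
    by measurable
  from indep_var_compose[OF ind weighted_chain_measurable[OF S_measurable q_measurable order_refl] this]
  show ?thesis
    by (simp add: comp_def weighted_chain_restrict Z_def[abs_def])
qed

lemma Z_measurable:
  assumes "k \<le> n" shows "Z k \<in> measurable M (borel \<Otimes>\<^sub>M borel)"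
  using assms
proof (induction k)
  case (Suc k)
  then have [measurable]: "Z k \<in> measurable M (borel \<Otimes>\<^sub>M borel)" "D k \<in> borel_measurable M"
    by (simp_all add: D_measurable)
  show ?case unfolding Z_simps by measurable
qed (simp add: Z_def[abs_def])

text \<open>Induction on joint moments of state and weight: one step bounds a moment by an earlier
  one times a moment of the independent increment. The power \<open>p\<close> is generalized because
  each step raises it.\<close>

lemma Z_moments:
  assumes "k \<le> n"
  shows "integrable M (\<lambda>\<omega>. (1 + norm (fst (Z k \<omega>))) ^ p * \<bar>snd (Z k \<omega>)\<bar> ^ r)"
  using assms
proof (induction k arbitrary: p)
  case (Suc k)
  then have k: "k < n" by simp
  note [measurable] = Z_measurable[OF Suc.prems] Z_measurable[of k] D_measurable[OF k]
  \<comment> \<open>The new state contributes the power \<open>p\<close>, and the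
    \<open>r\<close>-th power of the new weight contributes \<open>a * r\<close>.\<close>
  let ?s = "p + a * r"
  have "indep_var borel ((\<lambda>z. (1 + norm (fst z)) ^ ?s * \<bar>snd z\<bar> ^ r) \<circ> Z k)
      borel ((\<lambda>d. (1 + norm (fst d)) ^ ?s) \<circ> (\<lambda>\<omega>. (D k \<omega>, 0 :: real)))"
    by (rule indep_var_compose[OF indep_Z_D[OF k]]) measurable
  then have ind: "indep_var borel (\<lambda>\<omega>. (1 + norm (fst (Z k \<omega>))) ^ ?s * \<bar>snd (Z k \<omega>)\<bar> ^ r)
      borel (\<lambda>\<omega>. (1 + norm (D k \<omega>)) ^ ?s)"
    by (simp add: comp_def)
  have "integrable M (\<lambda>\<omega>. ((1 + norm (fst (Z k \<omega>))) ^ ?s * \<bar>snd (Z k \<omega>)\<bar> ^ r)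
      * (1 + norm (D k \<omega>)) ^ ?s)"
    by (rule indep_var_integrable[OF ind]) (use Suc.IH[of ?s] D_moments[OF k] k in simp_all)
  then have "integrable M (\<lambda>\<omega>. C ^ p * K ^ r * (((1 + norm (fst (Z k \<omega>))) ^ ?s
      * \<bar>snd (Z k \<omega>)\<bar> ^ r) * (1 + norm (D k \<omega>)) ^ ?s))"
    by (rule integrable_mult_right)
  then show ?case
  proof (rule Bochner_Integration.integrable_bound)
    show "AE \<omega> in M. norm ((1 + norm (fst (Z (Suc k) \<omega>))) ^ p * \<bar>snd (Z (Suc k) \<omega>)\<bar> ^ r)
      \<le> norm (C ^ p * K ^ r * (((1 + norm (fst (Z k \<omega>))) ^ ?s
      * \<bar>snd (Z k \<omega>)\<bar> ^ r) * (1 + norm (D k \<omega>)) ^ ?s))"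
    proof (rule AE_I2)
      fix \<omega>
      let ?x = "fst (Z k \<omega>)" and ?y = "snd (Z k \<omega>)" and ?d = "D k \<omega>"
      let ?B = "(1 + norm ?x) * (1 + norm ?d)"
      have "(1 + norm (S ?x ?d)) ^ p * (\<bar>?y\<bar> ^ r * \<bar>q ?x ?d\<bar> ^ r)
          \<le> (C * ?B) ^ p * (\<bar>?y\<bar> ^ r * (K * ?B ^ a) ^ r)"
        using C_nonneg
        by (intro mult_mono power_mono S_growth q_growth mult_nonneg_nonneg zero_le_power) simp_all
      also have "\<dots> = C ^ p * K ^ r * (((1 + norm ?x) ^ ?s * \<bar>?y\<bar> ^ r) * (1 + norm ?d) ^ ?s)"
        by (simp add: power_mult_distrib power_add power_mult[symmetric] mult_ac)
      finally show "norm ((1 + norm (fst (Z (Suc k) \<omega>))) ^ p * \<bar>snd (Z (Suc k) \<omega>)\<bar> ^ r)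
        \<le> norm (C ^ p * K ^ r * (((1 + norm ?x) ^ ?s * \<bar>?y\<bar> ^ r) * (1 + norm ?d) ^ ?s))"
        using C_nonneg K_nonneg
        by (simp add: Z_simps abs_mult power_mult_distrib)
    qed
  qed measurable
qed (simp add: Z_simps)

text \<open>Polynomial growth of \<open>g\<close> reduces this to \<open>Z_moments\<close>. Power 1
  gives the expectation, power 2 the second moment in the loss.\<close>

lemma integrable_weighted_power:
  assumes "k \<le> n" and [measurable]: "g \<in> borel_measurable borel" and "poly_growth g"
  shows "integrable M (\<lambda>\<omega>. (g (fst (Z k \<omega>)) * snd (Z k \<omega>)) ^ r)"
proof -
  note [measurable] = Z_measurable[OF assms(1)]
  obtain c p where c: "\<And>x. \<bar>g x\<bar> \<le> c * (1 + norm x) ^ p"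
    using assms(3) unfolding poly_growth_def by auto
  have c0: "0 \<le> c"
    using order_trans[OF abs_ge_zero c[of 0]] by simp
  have "integrable M (\<lambda>\<omega>. c ^ r * ((1 + norm (fst (Z k \<omega>))) ^ (p * r) * \<bar>snd (Z k \<omega>)\<bar> ^ r))"
    by (intro integrable_mult_right Z_moments assms(1))
  then show ?thesis
  proof (rule Bochner_Integration.integrable_bound)
    show "AE \<omega> in M. norm ((g (fst (Z k \<omega>)) * snd (Z k \<omega>)) ^ r)
      \<le> norm (c ^ r * ((1 + norm (fst (Z k \<omega>))) ^ (p * r) * \<bar>snd (Z k \<omega>)\<bar> ^ r))"
    proof (rule AE_I2)
      fix \<omega>
      have "\<bar>g (fst (Z k \<omega>))\<bar> ^ r * \<bar>snd (Z k \<omega>)\<bar> ^ r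
          \<le> (c * (1 + norm (fst (Z k \<omega>))) ^ p) ^ r * \<bar>snd (Z k \<omega>)\<bar> ^ r"
        by (intro mult_right_mono power_mono c) simp_all
      then show "norm ((g (fst (Z k \<omega>)) * snd (Z k \<omega>)) ^ r)
        \<le> norm (c ^ r * ((1 + norm (fst (Z k \<omega>))) ^ (p * r) * \<bar>snd (Z k \<omega>)\<bar> ^ r))"
        using c0 by (simp add: power_mult_distrib power_mult abs_mult power_abs mult.assoc)
    qed
  qed measurable
qed

text \<open>A parameter integral is measurable for a sigma-finite measure. In the applications
  \<open>G\<close> is the law of an increment, hence a probability measure.\<close>

lemma Q_measurable:
  assumes "sigma_finite_measure G" and [measurable]: "g \<in> borel_measurable borel"
  shows "Q g \<in> borel_measurable borel"
proof -
  interpret G: sigma_finite_measure G by fact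
  show ?thesis unfolding Q_def by measurable
qed

text \<open>Together with measurability this keeps the class of test functions closed under
  \<open>Q\<close>, so that \<open>Q\<close> can be iterated.\<close>

lemma Q_poly_growth:
  assumes "poly_growth g" and [measurable]: "g \<in> borel_measurable borel"
  shows "poly_growth (Q g)"
proof -
  obtain c p where c: "\<And>x. \<bar>g x\<bar> \<le> c * (1 + norm x) ^ p"
    using assms unfolding poly_growth_def by auto
  have c0: "0 \<le> c"
    using order_trans[OF abs_ge_zero c[of 0]] by simp
  \<comment> \<open>The increment enters with power \<open>p\<close> through
    \<open>g (S x w)\<close> and with power \<open>a\<close> through the weight.\<close>
  let ?m = "\<integral>w. (1 + norm w) ^ (p + a) \<partial>G"
  have "\<bar>Q g x\<bar> \<le> (c * C ^ p * K * ?m) * (1 + norm x) ^ (p + a)" for x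
  proof -
    let ?b = "\<lambda>w. (c * C ^ p * K * (1 + norm x) ^ (p + a)) * (1 + norm w) ^ (p + a)"
    have bound: "\<bar>g (S x w) * q x w\<bar> \<le> ?b w" for w
    proof -
      let ?B = "(1 + norm x) * (1 + norm w)"
      have "\<bar>g (S x w)\<bar> \<le> c * (C * ?B) ^ p"
        by (rule order_trans[OF c]) (intro mult_left_mono power_mono S_growth c0, simp)
      then have "\<bar>g (S x w)\<bar> * \<bar>q x w\<bar> \<le> (c * (C * ?B) ^ p) * (K * ?B ^ a)"
        by (intro mult_mono q_growth) (simp_all add: c0 C_nonneg)
      also have "\<dots> = ?b w"
        by (simp add: power_mult_distrib power_add mult_ac)
      finally show ?thesis by (simp add: abs_mult)
    qed
    have "\<bar>Q g x\<bar> \<le> (\<integral>w. ?b w \<partial>G)"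
    proof -
      have b: "integrable G ?b" by (intro integrable_mult_right moments)
      have "integrable G (\<lambda>w. g (S x w) * q x w)"
        by (rule Bochner_Integration.integrable_bound[OF b])
          (measurable, use bound in \<open>auto intro: order_trans[OF _ abs_ge_self]\<close>)
      then have "norm (\<integral>w. g (S x w) * q x w \<partial>G) \<le> (\<integral>w. ?b w \<partial>G)"
        using b bound by (intro Bochner_Integration.integral_norm_bound_integral) simp_all
      then show ?thesis by (simp add: Q_def)
    qed
    then show ?thesis by (simp add: mult_ac)
  qed
  then show ?thesis unfolding poly_growth_def by blast
qed

text \<open>The Markov step: with \<open>Z k\<close> frozen, the independent increment
  \<open>D k\<close> is integrated out under its law \<open>G\<close>, and the accumulated weight
  \<open>snd (Z k \<omega>)\<close> leaves the inner integral as a constant.\<close>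

lemma expectation_weighted_Suc:
  assumes k: "k < n" and g[measurable]: "g \<in> borel_measurable borel" and "poly_growth g"
  shows "expectation (\<lambda>\<omega>. g (fst (Z (Suc k) \<omega>)) * snd (Z (Suc k) \<omega>))
    = expectation (\<lambda>\<omega>. Q g (fst (Z k \<omega>)) * snd (Z k \<omega>))"
proof -
  note [measurable] = D_measurable[OF k]
  \<comment> \<open>Only \<open>fst d\<close> enters; the second component of \<open>d\<close> is
    the padding.\<close>
  let ?h = "\<lambda>(z, d :: (real^'d) \<times> real). g (S (fst z) (fst d)) * (snd z * q (fst z) (fst d))"
  have "expectation (\<lambda>\<omega>. ?h (Z k \<omega>, (D k \<omega>, 0)))
      = expectation (\<lambda>\<omega>. expectation (\<lambda>\<omega>'. ?h (Z k \<omega>, (D k \<omega>', 0))))"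
  proof (rule indep_var_integral_decouple[OF indep_Z_D[OF k]])
    show "?h \<in> borel_measurable ((borel \<Otimes>\<^sub>M borel) \<Otimes>\<^sub>M (borel \<Otimes>\<^sub>M borel))" by measurable
    show "integrable M (\<lambda>\<omega>. ?h (Z k \<omega>, (D k \<omega>, 0)))"
      using integrable_weighted_power[of "Suc k" g 1] assms by (simp add: Z_simps)
  qed
  also have "(\<lambda>\<omega>. expectation (\<lambda>\<omega>'. ?h (Z k \<omega>, (D k \<omega>', 0))))
      = (\<lambda>\<omega>. Q g (fst (Z k \<omega>)) * snd (Z k \<omega>))"
  proof
    fix \<omega>
    have "Q g (fst (Z k \<omega>))
        = (\<integral>w. g (S (fst (Z k \<omega>)) w) * q (fst (Z k \<omega>)) w \<partial>distr M borel (D k))"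
      by (simp only: Q_def law[OF k])
    also have "\<dots> = expectation (\<lambda>\<omega>'. g (S (fst (Z k \<omega>)) (D k \<omega>')) * q (fst (Z k \<omega>)) (D k \<omega>'))"
      by (rule integral_distr) measurable
    finally have "Q g (fst (Z k \<omega>))
        = expectation (\<lambda>\<omega>'. g (S (fst (Z k \<omega>)) (D k \<omega>')) * q (fst (Z k \<omega>)) (D k \<omega>'))" .
    then show "expectation (\<lambda>\<omega>'. ?h (Z k \<omega>, (D k \<omega>', 0)))
      = Q g (fst (Z k \<omega>)) * snd (Z k \<omega>)"
      by (simp add: mult.left_commute[of _ "snd (Z k \<omega>)"] mult.commute[of _ "snd (Z k \<omega>)"])
  qed
  finally show ?thesis by (simp add: Z_simps)
qed

text \<open>The test function is generalized, since peeling off the last step calls for the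
  induction hypothesis at \<open>Q g\<close>.\<close>

lemma expectation_weighted:
  assumes "k \<le> n" and "g \<in> borel_measurable borel" and "poly_growth g"
  shows "expectation (\<lambda>\<omega>. g (fst (Z k \<omega>)) * snd (Z k \<omega>)) = (Q ^^ k) g x0"
  using assms
proof (induction k arbitrary: g)
  case 0
  then show ?case by (simp add: Z_simps prob_space)
next
  case (Suc k)
  then have k: "k < n" by simp
  \<comment> \<open>An increment with index \<open>k\<close> exists here, and \<open>G\<close> is
    its law.\<close>
  interpret G: prob_space G
    using prob_space_distr[OF D_measurable[OF k]] law[OF k] by simp
  have "(Q ^^ k) (Q g) x0 = (Q ^^ Suc k) g x0"
    by (simp add: funpow_swap1)
  with Suc k show ?case
    by (simp add: expectation_weighted_Suc Q_measurable Q_poly_growth G.sigma_finite_measure_axioms)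
qed

end

section \<open>The Euler-Maruyama scheme with Malliavin weights as an instance of the
  recursion\<close>

theorem proposition1:
  fixes M :: "(real \<Rightarrow> real^'d::finite) measure"
    and W :: "real \<Rightarrow> (real \<Rightarrow> real^'d) \<Rightarrow> real^'d"
    and b :: "real^'d \<Rightarrow> real^'d"
    and \<sigma> :: "'d \<Rightarrow> real^'d \<Rightarrow> real^'d"
    and X :: "real^'d \<Rightarrow> real \<Rightarrow> (real \<Rightarrow> real^'d) \<Rightarrow> real^'d"
    and wt :: "real \<Rightarrow> real^'d \<Rightarrow> real^'d \<Rightarrow> real"
    and f :: "real^'d \<Rightarrow> real"
    and x0 :: "real^'d"
    and T L :: real
    and m n :: nat
  assumes "T > 0" and "m \<ge> 1" and "n \<ge> 1"
    and "wiener_space T M"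
    and "brownian_motion M T W"
    and "b \<in> Cb_inf" and "\<And>i. \<sigma> i \<in> Cb_inf"
    and "uniformly_elliptic \<sigma>"
    and "\<And>x. sde_solution M T W b \<sigma> x (X x)"
    and "malliavin_weight M W b \<sigma> X m wt"
    and "L-lipschitz_on UNIV f"
  defines "loss \<equiv> (\<lambda>v::real. \<integral>\<omega>. \<bar>v - f (euler_maruyama W b \<sigma> T n x0 n \<omega>) *
      (\<Prod>i=1..n. wt (T / real n) (euler_maruyama W b \<sigma> T n x0 (i - 1) \<omega>)
        (W (real i * T / real n) \<omega> - W (real (i - 1) * T / real n) \<omega>))\<bar>\<^sup>2 \<partial>M)"
  shows "(\<exists>!v. is_arg_min loss (\<lambda>_. True) v) \<and>
    (weak_approx_op M W b \<sigma> wt (T / real n) ^^ n) f x0 = (ARG_MIN loss v. True)"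
proof -
  define t where "t = T / real n"
  have t: "0 < t" "real n * t = T" using assms(1,3) by (simp_all add: t_def)
  have time: "real k * T / real n = real k * t" for k by (simp add: t_def)
  have time_le: "real k * t \<le> T" if "k \<le> n" for k
    using that t by (auto intro: mult_right_mono simp flip: t(2))
  have bm: "prob_space M" "\<And>s. s \<in> {0..T} \<Longrightarrow> W s \<in> borel_measurable M" "AE \<omega> in M. W 0 \<omega> = 0"
    "\<And>s u. 0 \<le> s \<Longrightarrow> s < u \<Longrightarrow> u \<le> T \<Longrightarrow> distributed M lborel (\<lambda>\<omega>. W u \<omega> - W s \<omega>)
       (\<lambda>y. ennreal (\<Prod>i\<in>UNIV. normal_density 0 (sqrt (u - s)) (y $ i)))"
    "\<And>(N::nat) \<tau>. (\<forall>k\<le>N. \<tau> k \<in> {0..T}) \<Longrightarrow> (\<forall>k<N. \<tau> k < \<tau> (Suc k)) \<Longrightarrow>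
       prob_space.indep_vars M (\<lambda>_. borel) (\<lambda>k \<omega>. W (\<tau> (Suc k)) \<omega> - W (\<tau> k) \<omega>) {..<N}"
    using assms(5) unfolding brownian_motion_def by auto
  interpret prob_space M by (rule bm(1))
  define D where "D k \<omega> = W (real (Suc k) * t) \<omega> - W (real k * t) \<omega>" for k \<omega>
  define G where "G = density lborel
    (\<lambda>y::real^'d. ennreal (\<Prod>i\<in>UNIV. normal_density 0 (sqrt t) (y $ i)))"
  have D_dist: "distributed M lborel (D k)
      (\<lambda>y. ennreal (\<Prod>i\<in>UNIV. normal_density 0 (sqrt t) (y $ i)))" if "k < n" for k
    using bm(4)[of "real k * t" "real (Suc k) * t"] time_le[of "Suc k"] that t
    by (simp add: D_def[abs_def] algebra_simps)
  have law: "distr M borel (D k) = G" if "k < n" for k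
  proof -
    \<comment> \<open>\<open>borel\<close> and \<open>lborel\<close> have the same measurable sets;
      the Brownian increments have their density with respect to \<open>lborel\<close>.\<close>
    have "distr M borel (D k) = distr M lborel (D k)" by (rule distr_cong) simp_all
    then show ?thesis
      using distributed_distr_eq_density[OF D_dist[OF that]] by (simp add: G_def)
  qed
  have "indep_vars (\<lambda>_. borel) (\<lambda>k \<omega>. W (real (Suc k) * t) \<omega> - W (real k * t) \<omega>) {..<n}"
    \<comment> \<open>Independence of increments along the uniform grid of step
      \<open>t\<close>.\<close>
    using bm(5)[of n "\<lambda>k. real k * t"] time_le t by simp
  then have indep: "indep_vars (\<lambda>_. borel) D {..<n}"
    by (simp add: D_def[abs_def])
  \<comment> \<open>At least one increment exists, so facts about \<open>G\<close> can be read off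
    \<open>D 0\<close>.\<close>
  have n0: "0 < n" using assms(3) by simp
  have moments: "integrable G (\<lambda>w. (1 + norm w) ^ p)" for p
  proof -
    have [measurable]: "D 0 \<in> borel_measurable M"
      using D_dist[OF n0] by (auto dest: distributed_measurable)
    show ?thesis
      unfolding law[OF n0, symmetric]
      using gaussian_integrable_power[OF _ D_dist[OF n0], of p] t
      by (subst integrable_distr_eq) simp_all
  qed
  have pw: "poly_weight (wt t)"
    using assms(10) t(1) unfolding malliavin_weight_def by blast
  have b_meas: "b \<in> borel_measurable borel" and \<sigma>_meas: "\<And>i. \<sigma> i \<in> borel_measurable borel"
    using Cb_inf_continuous_bounded(1) assms(6,7) by (auto intro: borel_measurable_continuous_onI)
  obtain C where C: "\<And>x w. 1 + norm (em_step b \<sigma> t x w) \<le> C * ((1 + norm x) * (1 + norm w))"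
    using em_step_growth[of b \<sigma> t] Cb_inf_continuous_bounded(2) assms(6,7) by blast
  obtain K a where K: "\<And>x w. \<bar>wt t x w\<bar> \<le> K * ((1 + norm x) * (1 + norm w)) ^ a"
    using poly_weight_growth[OF pw] by blast
  interpret weighted_recursion M D n G "em_step b \<sigma> t" "wt t" x0 C K a
  proof unfold_locales
    show "sets G = sets borel" by (simp add: G_def)
  qed (fact indep law moments em_step_measurable[OF b_meas \<sigma>_meas]
    poly_weight_measurable[OF pw] C K)+
  \<comment> \<open>Chain index \<open>k\<close> corresponds to the factor \<open>i = k + 1\<close>
    of the product, which explains the shift \<open>i - 1\<close>.\<close>
  have Z: "Z k \<omega> = (euler_maruyama W b \<sigma> T n x0 k \<omega>,
      \<Prod>i=1..k. wt t (euler_maruyama W b \<sigma> T n x0 (i - 1) \<omega>)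
        (W (real i * t) \<omega> - W (real (i - 1) * t) \<omega>))" for k \<omega>
  proof (induction k)
    case (Suc k)
    have D: "D k \<omega> = W (real (Suc k) * t) \<omega> - W (real k * t) \<omega>" by (simp only: D_def)
    show ?case
      unfolding Z_simps D Suc by (simp add: time t_def[symmetric] del: of_nat_Suc of_nat_diff)
  qed (simp add: Z_simps)
  have f_meas[measurable]: "f \<in> borel_measurable borel"
    by (intro borel_measurable_continuous_onI lipschitz_on_continuous_on[OF assms(11)])
  have f_growth: "poly_growth f" by (rule lipschitz_poly_growth[OF assms(11)])
  let ?Y = "\<lambda>\<omega>. f (fst (Z n \<omega>)) * snd (Z n \<omega>)"
  have loss: "loss = (\<lambda>v. \<integral>\<omega>. \<bar>v - ?Y \<omega>\<bar>\<^sup>2 \<partial>M)"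
    by (simp add: loss_def Z time t_def[symmetric] del: of_nat_diff)
  have Q_eq: "weak_approx_op M W b \<sigma> wt t g = Q g" if [measurable]: "g \<in> borel_measurable borel" for g
  proof
    fix x
    have [measurable]: "D 0 \<in> borel_measurable M" "W t \<in> borel_measurable M"
      using D_measurable[OF n0] bm(2)[of t] time_le[of 1] n0 t by simp_all
    have [measurable]: "em_step b \<sigma> t x \<in> borel_measurable borel" "wt t x \<in> borel_measurable borel"
      using S_measurable q_measurable by measurable
    \<comment> \<open>The operator is defined with \<open>W t\<close>, the recursion uses
      \<open>D 0\<close>; they agree almost surely because the Brownian motion starts at 0 almost
      surely.\<close>
    have D0: "AE \<omega> in M. W t \<omega> = D 0 \<omega>"
      using bm(3) by eventually_elim (simp add: D_def)
    have "weak_approx_op M W b \<sigma> wt t g x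
        = expectation (\<lambda>\<omega>. g (em_step b \<sigma> t x (D 0 \<omega>)) * wt t x (D 0 \<omega>))"
      unfolding weak_approx_op_def using D0 by (intro integral_cong_AE) auto
    also have "\<dots> = (\<integral>w. g (em_step b \<sigma> t x w) * wt t x w \<partial>distr M borel (D 0))"
      by (rule integral_distr[symmetric]) measurable
    also have "\<dots> = Q g x"
      by (simp only: Q_def law[OF n0])
    finally show "weak_approx_op M W b \<sigma> wt t g x = Q g x" .
  qed
  interpret G: prob_space G
    using prob_space_distr[OF D_measurable[OF n0]] law[OF n0] by simp
  \<comment> \<open>The two operators are identified on measurable functions only. The iterate is
    therefore unfolded from the inside, with \<open>Q g\<close> as the next measurable
    argument.\<close>
  have iter_eq: "(weak_approx_op M W b \<sigma> wt t ^^ k) g = (Q ^^ k) g"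
    if "g \<in> borel_measurable borel" for k g
    using that
    by (induction k arbitrary: g)
      (simp_all add: funpow_Suc_right Q_eq Q_measurable G.sigma_finite_measure_axioms
        del: funpow.simps(2))
  have "is_arg_min loss (\<lambda>_. True) v \<longleftrightarrow> v = expectation ?Y" for v
    unfolding loss using integrable_weighted_power[OF order_refl f_meas f_growth, of 1]
      integrable_weighted_power[OF order_refl f_meas f_growth, of 2]
    by (intro is_arg_min_mean_square_iff prob_space_axioms) simp_all
  \<comment> \<open>The minimizers are exactly the values equal to the mean, so the choice made by
    \<open>ARG_MIN\<close> is forced.\<close>
  then show ?thesis
    using expectation_weighted[OF order_refl f_meas f_growth]
    by (simp add: arg_min_def iter_eq t_def[symmetric])
qed

end
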